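(* Let $\mathcal{N},\mathcal{N}',\mathcal{M},\mathcal{M}'$ be model categories, let $F:\mathcal{N}\to\mathcal{M}$ and $F':\mathcal{N}'\to\mathcal{M}'$ be functors, and let $\tilde{A}:\mathcal{N}\rightleftarrows\mathcal{N}':\tilde{B}$ and $A:\mathcal{M}\rightleftarrows\mathcal{M}':B$ be adjunctions ($\tilde{A}\dashv\tilde{B}$, $A\dashv B$) with counits $\tilde{\varepsilon}$ and $\varepsilon$, respectively. Suppose that $(F,F')$ is a map of adjunctions from $(\tilde A\dashv\tilde B)$ to $(A\dashv B)$, that is, $AF=F'\tilde{A}$, $F\tilde{B}=BF'$, and $F'\tilde{\varepsilon}_f=\varepsilon_{F'f}$ for every object $f$ of $\mathcal{N}'$. Suppose further that $(A,B)$ is a Quillen equivalence and that: - $F$ and $F'$ create weak equivalences; - $F$ reflects fibrations and preserves cofibrant objects; - $F'$ preserves fibrations and fibrant objects. Then $(\tilde{A},\tilde{B})$ is a Quillen equivalence.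
   Context: A functor $F:\mathcal{N}\to\mathcal{M}$ between model categories creates weak equivalences if, for each morphism $f$ of $\mathcal{N}$, $f$ is a weak equivalence in $\mathcal{N}$ if and only if $F(f)$ is a weak equivalence in $\mathcal{M}$. It reflects fibrations if $f$ is a fibration whenever $F(f)$ is. *)

theory Defs
  imports Main
begin

section \<open>Categories and functors\<close>

record ('o, 'm) cat =
  Obj :: "'o set"
  Arr :: "'m set"
  Dom :: "'m \<Rightarrow> 'o"
  Cod :: "'m \<Rightarrow> 'o"
  Id :: "'o \<Rightarrow> 'm"
  Comp :: "'m \<Rightarrow> 'm \<Rightarrow> 'm" (infixl "\<cdot>\<index>" 70)

definition hom_set :: "('o, 'm, 'z) cat_scheme \<Rightarrow> 'o \<Rightarrow> 'o \<Rightarrow> 'm set" where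
  "hom_set C X Y = {f \<in> Arr C. Dom C f = X \<and> Cod C f = Y}"

locale category =
  fixes C :: "('o, 'm, 'z) cat_scheme" (structure)
  assumes Dom_in_Obj: "f \<in> Arr C \<Longrightarrow> Dom C f \<in> Obj C"
    and Cod_in_Obj: "f \<in> Arr C \<Longrightarrow> Cod C f \<in> Obj C"
    and Id_in_hom: "X \<in> Obj C \<Longrightarrow> Id C X \<in> hom_set C X X"
    and Comp_in_hom: "f \<in> hom_set C X Y \<Longrightarrow> g \<in> hom_set C Y Z \<Longrightarrow> g \<cdot> f \<in> hom_set C X Z"
    and Comp_Id: "f \<in> hom_set C X Y \<Longrightarrow> f \<cdot> Id C X = f"
    and Id_Comp: "f \<in> hom_set C X Y \<Longrightarrow> Id C Y \<cdot> f = f"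
    and Comp_assoc: "f \<in> hom_set C W X \<Longrightarrow> g \<in> hom_set C X Y \<Longrightarrow> h \<in> hom_set C Y Z
      \<Longrightarrow> (h \<cdot> g) \<cdot> f = h \<cdot> (g \<cdot> f)"

record ('o, 'm, 'p, 'n) fun_data =
  omap :: "'o \<Rightarrow> 'p"
  amap :: "'m \<Rightarrow> 'n"

locale cat_functor = src: category C + tgt: category D
  for C :: "('o, 'm, 'y) cat_scheme" and D :: "('p, 'n, 'z) cat_scheme" +
  fixes F :: "('o, 'm, 'p, 'n) fun_data"
  assumes omap_in_Obj: "X \<in> Obj C \<Longrightarrow> omap F X \<in> Obj D"
    and amap_in_hom: "f \<in> hom_set C X Y \<Longrightarrow> amap F f \<in> hom_set D (omap F X) (omap F Y)"
    and amap_Id: "X \<in> Obj C \<Longrightarrow> amap F (Id C X) = Id D (omap F X)"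
    and amap_Comp: "f \<in> hom_set C X Y \<Longrightarrow> g \<in> hom_set C Y Z
      \<Longrightarrow> amap F (g \<cdot>\<^bsub>C\<^esub> f) = amap F g \<cdot>\<^bsub>D\<^esub> amap F f"

definition fun_id :: "('o, 'm, 'o, 'm) fun_data" where
  "fun_id = \<lparr>omap = \<lambda>X. X, amap = \<lambda>f. f\<rparr>"

definition fun_comp ::
  "('p, 'n, 'q, 'k) fun_data \<Rightarrow> ('o, 'm, 'p, 'n) fun_data \<Rightarrow> ('o, 'm, 'q, 'k) fun_data"
  (infixl "\<odot>" 75) where
  "G \<odot> F = \<lparr>omap = \<lambda>X. omap G (omap F X), amap = \<lambda>f. amap G (amap F f)\<rparr>"

text \<open>Equality of functors with source \<open>C\<close>. The values of the maps outside the
  objects and arrows of \<open>C\<close> are junk and are not compared.\<close>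

definition fun_eq ::
  "('o, 'm, 'z) cat_scheme \<Rightarrow> ('o, 'm, 'p, 'n) fun_data \<Rightarrow> ('o, 'm, 'p, 'n) fun_data \<Rightarrow> bool" where
  "fun_eq C F G \<longleftrightarrow>
    (\<forall>X \<in> Obj C. omap F X = omap G X) \<and> (\<forall>f \<in> Arr C. amap F f = amap G f)"

locale nat_trans = F: cat_functor C D F + G: cat_functor C D G
  for C :: "('o, 'm, 'y) cat_scheme" and D :: "('p, 'n, 'z) cat_scheme"
    and F :: "('o, 'm, 'p, 'n) fun_data" and G :: "('o, 'm, 'p, 'n) fun_data" +
  fixes \<tau> :: "'o \<Rightarrow> 'n"
  assumes component_in_hom: "X \<in> Obj C \<Longrightarrow> \<tau> X \<in> hom_set D (omap F X) (omap G X)"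
    and naturality: "f \<in> hom_set C X Y
      \<Longrightarrow> \<tau> Y \<cdot>\<^bsub>D\<^esub> amap F f = amap G f \<cdot>\<^bsub>D\<^esub> \<tau> X"


section \<open>Adjunctions\<close>

locale adjunction =
  left: cat_functor C D A + right: cat_functor D C B +
  unit: nat_trans C C fun_id "B \<odot> A" \<eta> + counit: nat_trans D D "A \<odot> B" fun_id \<epsilon>
  for C :: "('o, 'm, 'y) cat_scheme" and D :: "('p, 'n, 'z) cat_scheme"
    and A :: "('o, 'm, 'p, 'n) fun_data" and B :: "('p, 'n, 'o, 'm) fun_data"
    and \<eta> :: "'o \<Rightarrow> 'm" and \<epsilon> :: "'p \<Rightarrow> 'n" +
  assumes triangle_left:
    "X \<in> Obj C \<Longrightarrow> \<epsilon> (omap A X) \<cdot>\<^bsub>D\<^esub> amap A (\<eta> X) = Id D (omap A X)"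
    and triangle_right:
    "Y \<in> Obj D \<Longrightarrow> amap B (\<epsilon> Y) \<cdot>\<^bsub>C\<^esub> \<eta> (omap B Y) = Id C (omap B Y)"

text \<open>The adjunct \<open>X \<rightarrow> B Y\<close> of \<open>g : A X \<rightarrow> Y\<close>. The source object \<open>X\<close> is an
  argument because \<open>g\<close> does not determine it.\<close>

definition adjunct ::
  "('o, 'm, 'y) cat_scheme \<Rightarrow> ('p, 'n, 'o, 'm) fun_data \<Rightarrow> ('o \<Rightarrow> 'm) \<Rightarrow> 'o \<Rightarrow> 'n \<Rightarrow> 'm" where
  "adjunct C B \<eta> X g = amap B g \<cdot>\<^bsub>C\<^esub> \<eta> X"

text \<open>A map \<open>(F, F')\<close> between adjunctions \<open>(A1 \<stileturn> B1)\<close>, from \<open>N\<close> to \<open>N'\<close>, and \<open>(A \<stileturn> B)\<close>,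
  from \<open>M\<close> to \<open>M'\<close>; the squares commute strictly.\<close>

definition map_of_adjunctions where
  "map_of_adjunctions N N' A1 B1 \<eta>1 \<epsilon>1 M M' A B \<eta> \<epsilon> F F' \<longleftrightarrow>
    adjunction N N' A1 B1 \<eta>1 \<epsilon>1 \<and> adjunction M M' A B \<eta> \<epsilon> \<and>
    cat_functor N M F \<and> cat_functor N' M' F' \<and>
    fun_eq N (A \<odot> F) (F' \<odot> A1) \<and>
    fun_eq N' (F \<odot> B1) (B \<odot> F') \<and>
    (\<forall>Y \<in> Obj N'. amap F' (\<epsilon>1 Y) = \<epsilon> (omap F' Y))"


section \<open>Limits and colimits\<close>

definition is_cone ::
  "('j, 'i, 'y) cat_scheme \<Rightarrow> ('o, 'm, 'z) cat_scheme \<Rightarrow> ('j, 'i, 'o, 'm) fun_data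
    \<Rightarrow> 'o \<Rightarrow> ('j \<Rightarrow> 'm) \<Rightarrow> bool" where
  "is_cone J C D X L \<longleftrightarrow> X \<in> Obj C \<and>
    (\<forall>j \<in> Obj J. L j \<in> hom_set C X (omap D j)) \<and>
    (\<forall>u \<in> Arr J. amap D u \<cdot>\<^bsub>C\<^esub> L (Dom J u) = L (Cod J u))"

definition is_cocone ::
  "('j, 'i, 'y) cat_scheme \<Rightarrow> ('o, 'm, 'z) cat_scheme \<Rightarrow> ('j, 'i, 'o, 'm) fun_data
    \<Rightarrow> 'o \<Rightarrow> ('j \<Rightarrow> 'm) \<Rightarrow> bool" where
  "is_cocone J C D X L \<longleftrightarrow> X \<in> Obj C \<and>
    (\<forall>j \<in> Obj J. L j \<in> hom_set C (omap D j) X) \<and>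
    (\<forall>u \<in> Arr J. L (Cod J u) \<cdot>\<^bsub>C\<^esub> amap D u = L (Dom J u))"

definition is_limit ::
  "('j, 'i, 'y) cat_scheme \<Rightarrow> ('o, 'm, 'z) cat_scheme \<Rightarrow> ('j, 'i, 'o, 'm) fun_data
    \<Rightarrow> 'o \<Rightarrow> ('j \<Rightarrow> 'm) \<Rightarrow> bool" where
  "is_limit J C D X L \<longleftrightarrow> is_cone J C D X L \<and>
    (\<forall>Y K. is_cone J C D Y K \<longrightarrow>
      (\<exists>!h. h \<in> hom_set C Y X \<and> (\<forall>j \<in> Obj J. L j \<cdot>\<^bsub>C\<^esub> h = K j)))"

definition is_colimit ::
  "('j, 'i, 'y) cat_scheme \<Rightarrow> ('o, 'm, 'z) cat_scheme \<Rightarrow> ('j, 'i, 'o, 'm) fun_data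
    \<Rightarrow> 'o \<Rightarrow> ('j \<Rightarrow> 'm) \<Rightarrow> bool" where
  "is_colimit J C D X L \<longleftrightarrow> is_cocone J C D X L \<and>
    (\<forall>Y K. is_cocone J C D Y K \<longrightarrow>
      (\<exists>!h. h \<in> hom_set C X Y \<and> (\<forall>j \<in> Obj J. h \<cdot>\<^bsub>C\<^esub> L j = K j)))"

text \<open>Smallness is relative to a type \<open>'s\<close>: a small category is one whose objects and
  arrows are both taken from \<open>'s\<close>. Results polymorphic in \<open>'s\<close> hold for every choice of
  size bound.\<close>

definition complete_cat :: "'s itself \<Rightarrow> ('o, 'm, 'z) cat_scheme \<Rightarrow> bool" where
  "complete_cat S C \<longleftrightarrow> (\<forall>(J :: ('s, 's) cat) D. cat_functor J C D \<longrightarrow> (\<exists>X L. is_limit J C D X L))"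

definition cocomplete_cat :: "'s itself \<Rightarrow> ('o, 'm, 'z) cat_scheme \<Rightarrow> bool" where
  "cocomplete_cat S C \<longleftrightarrow> (\<forall>(J :: ('s, 's) cat) D. cat_functor J C D \<longrightarrow> (\<exists>X L. is_colimit J C D X L))"

definition initial :: "('o, 'm, 'z) cat_scheme \<Rightarrow> 'o \<Rightarrow> bool" where
  "initial C X \<longleftrightarrow> X \<in> Obj C \<and> (\<forall>Y \<in> Obj C. \<exists>!f. f \<in> hom_set C X Y)"

definition terminal :: "('o, 'm, 'z) cat_scheme \<Rightarrow> 'o \<Rightarrow> bool" where
  "terminal C X \<longleftrightarrow> X \<in> Obj C \<and> (\<forall>Y \<in> Obj C. \<exists>!f. f \<in> hom_set C Y X)"


section \<open>Model categories\<close>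

definition retract_of :: "('o, 'm, 'z) cat_scheme \<Rightarrow> 'm \<Rightarrow> 'm \<Rightarrow> bool" where
  "retract_of C f g \<longleftrightarrow> f \<in> Arr C \<and> g \<in> Arr C \<and>
    (\<exists>i \<in> hom_set C (Dom C f) (Dom C g). \<exists>r \<in> hom_set C (Dom C g) (Dom C f).
     \<exists>i' \<in> hom_set C (Cod C f) (Cod C g). \<exists>r' \<in> hom_set C (Cod C g) (Cod C f).
      r \<cdot>\<^bsub>C\<^esub> i = Id C (Dom C f) \<and> r' \<cdot>\<^bsub>C\<^esub> i' = Id C (Cod C f) \<and>
      g \<cdot>\<^bsub>C\<^esub> i = i' \<cdot>\<^bsub>C\<^esub> f \<and> f \<cdot>\<^bsub>C\<^esub> r = r' \<cdot>\<^bsub>C\<^esub> g)"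

definition lifts_against :: "('o, 'm, 'z) cat_scheme \<Rightarrow> 'm \<Rightarrow> 'm \<Rightarrow> bool" where
  "lifts_against C i p \<longleftrightarrow>
    (\<forall>f \<in> hom_set C (Dom C i) (Dom C p). \<forall>g \<in> hom_set C (Cod C i) (Cod C p).
      p \<cdot>\<^bsub>C\<^esub> f = g \<cdot>\<^bsub>C\<^esub> i \<longrightarrow>
      (\<exists>h \<in> hom_set C (Cod C i) (Dom C p). h \<cdot>\<^bsub>C\<^esub> i = f \<and> p \<cdot>\<^bsub>C\<^esub> h = g))"

record ('o, 'm) model_cat = "('o, 'm) cat" +
  Weq :: "'m set"
  Fib :: "'m set"
  Cof :: "'m set"

text \<open>The factorizations are not required to be functorial.\<close>

locale model_category = category M
  for S :: "'s itself" and M :: "('o, 'm) model_cat" (structure) +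
  assumes classes: "Weq M \<subseteq> Arr M" "Fib M \<subseteq> Arr M" "Cof M \<subseteq> Arr M"
    and complete: "complete_cat S M"
    and cocomplete: "cocomplete_cat S M"
    and two_of_three: "f \<in> hom_set M X Y \<Longrightarrow> g \<in> hom_set M Y Z \<Longrightarrow>
      (f \<in> Weq M \<and> g \<in> Weq M \<longrightarrow> g \<cdot> f \<in> Weq M) \<and>
      (f \<in> Weq M \<and> g \<cdot> f \<in> Weq M \<longrightarrow> g \<in> Weq M) \<and>
      (g \<in> Weq M \<and> g \<cdot> f \<in> Weq M \<longrightarrow> f \<in> Weq M)"
    and retract_Weq: "retract_of M f g \<Longrightarrow> g \<in> Weq M \<Longrightarrow> f \<in> Weq M"
    and retract_Fib: "retract_of M f g \<Longrightarrow> g \<in> Fib M \<Longrightarrow> f \<in> Fib M"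
    and retract_Cof: "retract_of M f g \<Longrightarrow> g \<in> Cof M \<Longrightarrow> f \<in> Cof M"
    and lift_Cof_trivial_Fib:
      "i \<in> Cof M \<Longrightarrow> p \<in> Fib M \<inter> Weq M \<Longrightarrow> lifts_against M i p"
    and lift_trivial_Cof_Fib:
      "i \<in> Cof M \<inter> Weq M \<Longrightarrow> p \<in> Fib M \<Longrightarrow> lifts_against M i p"
    and factor_Cof_trivial_Fib: "f \<in> Arr M \<Longrightarrow>
      \<exists>i \<in> Cof M. \<exists>p \<in> Fib M \<inter> Weq M. Cod M i = Dom M p \<and> f = p \<cdot> i"
    and factor_trivial_Cof_Fib: "f \<in> Arr M \<Longrightarrow>
      \<exists>i \<in> Cof M \<inter> Weq M. \<exists>p \<in> Fib M. Cod M i = Dom M p \<and> f = p \<cdot> i"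

definition fibrant :: "('o, 'm) model_cat \<Rightarrow> 'o \<Rightarrow> bool" where
  "fibrant M X \<longleftrightarrow> X \<in> Obj M \<and> (\<exists>T t. terminal M T \<and> t \<in> hom_set M X T \<and> t \<in> Fib M)"

definition cofibrant :: "('o, 'm) model_cat \<Rightarrow> 'o \<Rightarrow> bool" where
  "cofibrant M X \<longleftrightarrow> X \<in> Obj M \<and> (\<exists>I t. initial M I \<and> t \<in> hom_set M I X \<and> t \<in> Cof M)"

text \<open>As in Hovey, a Quillen adjunction is one whose left adjoint is a left Quillen functor,
  and Quillen equivalences are defined through adjuncts.\<close>

definition quillen_adjunction where
  "quillen_adjunction M M' A B \<eta> \<epsilon> \<longleftrightarrow> adjunction M M' A B \<eta> \<epsilon> \<and>
    (\<forall>f \<in> Cof M. amap A f \<in> Cof M') \<and>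
    (\<forall>f \<in> Cof M \<inter> Weq M. amap A f \<in> Cof M' \<inter> Weq M')"

definition quillen_equivalence where
  "quillen_equivalence M M' A B \<eta> \<epsilon> \<longleftrightarrow> quillen_adjunction M M' A B \<eta> \<epsilon> \<and>
    (\<forall>X Y g. cofibrant M X \<longrightarrow> fibrant M' Y \<longrightarrow> g \<in> hom_set M' (omap A X) Y \<longrightarrow>
      (g \<in> Weq M' \<longleftrightarrow> adjunct M B \<eta> X g \<in> Weq M))"

definition creates_weak_equivalences ::
  "('o, 'm) model_cat \<Rightarrow> ('p, 'n) model_cat \<Rightarrow> ('o, 'm, 'p, 'n) fun_data \<Rightarrow> bool" where
  "creates_weak_equivalences N M F \<longleftrightarrow> (\<forall>f \<in> Arr N. f \<in> Weq N \<longleftrightarrow> amap F f \<in> Weq M)"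

definition preserves_fibrations ::
  "('o, 'm) model_cat \<Rightarrow> ('p, 'n) model_cat \<Rightarrow> ('o, 'm, 'p, 'n) fun_data \<Rightarrow> bool" where
  "preserves_fibrations N M F \<longleftrightarrow> (\<forall>f \<in> Arr N. f \<in> Fib N \<longrightarrow> amap F f \<in> Fib M)"

definition reflects_fibrations ::
  "('o, 'm) model_cat \<Rightarrow> ('p, 'n) model_cat \<Rightarrow> ('o, 'm, 'p, 'n) fun_data \<Rightarrow> bool" where
  "reflects_fibrations N M F \<longleftrightarrow> (\<forall>f \<in> Arr N. amap F f \<in> Fib M \<longrightarrow> f \<in> Fib N)"

definition preserves_cofibrant_objects ::
  "('o, 'm) model_cat \<Rightarrow> ('p, 'n) model_cat \<Rightarrow> ('o, 'm, 'p, 'n) fun_data \<Rightarrow> bool" where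
  "preserves_cofibrant_objects N M F \<longleftrightarrow> (\<forall>X. cofibrant N X \<longrightarrow> cofibrant M (omap F X))"

definition preserves_fibrant_objects ::
  "('o, 'm) model_cat \<Rightarrow> ('p, 'n) model_cat \<Rightarrow> ('o, 'm, 'p, 'n) fun_data \<Rightarrow> bool" where
  "preserves_fibrant_objects N M F \<longleftrightarrow> (\<forall>X. fibrant N X \<longrightarrow> fibrant M (omap F X))"

end

theory Submission
  imports Defs
begin

text \<open>
  The structure on \<open>(At, Bt)\<close> is transported along \<open>F\<close> and \<open>F'\<close>.

  By adjunction, a square from \<open>At i\<close> to \<open>p\<close> has a filler exactly when the corresponding square
  from \<open>i\<close> to \<open>Bt p\<close> has one (\<open>adjunction.lifts_against_iff\<close>). In a model category the cofibrations
  and the trivial cofibrations are the maps that lift against all trivial fibrations and against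
  all fibrations, respectively, and dually. So being a left Quillen functor is equivalent
  to the right adjoint preserving fibrations and trivial fibrations
  (\<open>quillen_adjunction_iff_right\<close>). This form can be transported: if \<open>p\<close> is a (trivial) fibration,
  then \<open>F (Bt p) = B (F' p)\<close> is one because \<open>F'\<close> and \<open>B\<close> preserve them, and \<open>F\<close> reflects this
  back to \<open>Bt p\<close>.

  For the equivalence, let \<open>g : At X \<rightarrow> Y\<close> with \<open>X\<close> cofibrant and \<open>Y\<close> fibrant. A map of adjunctions
  is assumed compatible with the counits only, but transposing makes it compatible with the units as
  well, so \<open>F\<close> sends the adjunct of \<open>g\<close> to the adjunct of \<open>F' g\<close>
  (\<open>map_of_adjunctions_adjunct\<close>). Since \<open>F X\<close> is cofibrant and \<open>F' Y\<close> is fibrant, the Quillen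
  equivalence \<open>(A, B)\<close> says that \<open>F' g\<close> is a weak equivalence if and only if its adjunct is; as
  \<open>F\<close> and \<open>F'\<close> create weak equivalences, the same holds for \<open>g\<close>.
\<close>

section \<open>The retract argument\<close>

context category
begin

lemma in_hom: "f \<in> Arr C \<Longrightarrow> f \<in> hom_set C (Dom C f) (Cod C f)"
  by (simp add: hom_set_def)

lemma composite_in_hom:
  assumes "i \<in> Arr C" and "p \<in> Arr C" and "Cod C i = Dom C p"
  shows "p \<cdot> i \<in> hom_set C (Dom C i) (Cod C p)"
  using Comp_in_hom[OF in_hom[OF assms(1)]] in_hom[OF assms(2)] assms(3) by simp

text \<open>A filler of the square with top \<open>i\<close>, left side \<open>p \<cdot> i\<close>, right side \<open>p\<close> and bottom the
  identity is a section of \<open>p\<close> under the source; together with \<open>p\<close> it exhibits the retract.\<close>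

lemma retract_of_first_factor:
  assumes i: "i \<in> Arr C" and p: "p \<in> Arr C" and ip: "Cod C i = Dom C p"
    and lift: "lifts_against C (p \<cdot> i) p"
  shows "retract_of C (p \<cdot> i) i"
proof -
  have f: "p \<cdot> i \<in> hom_set C (Dom C i) (Cod C p)"
    by (rule composite_in_hom[OF i p ip])
  then have fa: "p \<cdot> i \<in> Arr C" "Dom C (p \<cdot> i) = Dom C i" "Cod C (p \<cdot> i) = Cod C p"
    by (auto simp: hom_set_def)
  have ih: "i \<in> hom_set C (Dom C i) (Dom C p)" and ph: "p \<in> hom_set C (Dom C p) (Cod C p)"
    using in_hom[OF i] in_hom[OF p] ip by auto
  have id1: "Id C (Dom C i) \<in> hom_set C (Dom C i) (Dom C i)"
    and id2: "Id C (Cod C p) \<in> hom_set C (Cod C p) (Cod C p)"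
    using i p by (auto intro: Id_in_hom Dom_in_Obj Cod_in_Obj)
  have "p \<cdot> i = Id C (Cod C p) \<cdot> (p \<cdot> i)"
    using Id_Comp[OF f] by simp
  then obtain h where h: "h \<in> hom_set C (Cod C p) (Dom C p)"
    and hi: "h \<cdot> (p \<cdot> i) = i" and hp: "p \<cdot> h = Id C (Cod C p)"
    using lift ih id2 unfolding lifts_against_def fa by blast
  show ?thesis
    unfolding retract_of_def fa
  proof (intro conjI bexI)
    show "Id C (Dom C i) \<cdot> Id C (Dom C i) = Id C (Dom C i)"
      by (rule Comp_Id[OF id1])
    show "i \<cdot> Id C (Dom C i) = h \<cdot> (p \<cdot> i)"
      using Comp_Id[OF ih] hi by simp
    show "p \<cdot> i \<cdot> Id C (Dom C i) = p \<cdot> i"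
      by (rule Comp_Id[OF f])
  qed (use i fa hp h ph id1 ip in auto)
qed

text \<open>Dually, the filler of the square with top the identity, left side \<open>i\<close>, right side \<open>p \<cdot> i\<close> and
  bottom \<open>p\<close> is a retraction of \<open>i\<close> over the target.\<close>

lemma retract_of_second_factor:
  assumes i: "i \<in> Arr C" and p: "p \<in> Arr C" and ip: "Cod C i = Dom C p"
    and lift: "lifts_against C i (p \<cdot> i)"
  shows "retract_of C (p \<cdot> i) p"
proof -
  have f: "p \<cdot> i \<in> hom_set C (Dom C i) (Cod C p)"
    by (rule composite_in_hom[OF i p ip])
  then have fa: "p \<cdot> i \<in> Arr C" "Dom C (p \<cdot> i) = Dom C i" "Cod C (p \<cdot> i) = Cod C p"
    by (auto simp: hom_set_def)
  have ih: "i \<in> hom_set C (Dom C i) (Dom C p)" and ph: "p \<in> hom_set C (Dom C p) (Cod C p)"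
    using in_hom[OF i] in_hom[OF p] ip by auto
  have id1: "Id C (Dom C i) \<in> hom_set C (Dom C i) (Dom C i)"
    and id2: "Id C (Cod C p) \<in> hom_set C (Cod C p) (Cod C p)"
    using i p by (auto intro: Id_in_hom Dom_in_Obj Cod_in_Obj)
  have "p \<cdot> i \<cdot> Id C (Dom C i) = p \<cdot> i"
    by (rule Comp_Id[OF f])
  then obtain h where h: "h \<in> hom_set C (Dom C p) (Dom C i)"
    and hi: "h \<cdot> i = Id C (Dom C i)" and hp: "p \<cdot> i \<cdot> h = p"
    using lift ph id1 unfolding lifts_against_def fa ip by blast
  show ?thesis
    unfolding retract_of_def fa
  proof (intro conjI bexI)
    show "Id C (Cod C p) \<cdot> Id C (Cod C p) = Id C (Cod C p)"
      by (rule Comp_Id[OF id2])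
    show "p \<cdot> i = Id C (Cod C p) \<cdot> (p \<cdot> i)"
      using Id_Comp[OF f] by simp
    show "p \<cdot> i \<cdot> h = Id C (Cod C p) \<cdot> p"
      using Id_Comp[OF ph] hp by simp
  qed (use p fa hi h ih id2 in auto)
qed

end

section \<open>Lifting characterizations of the classes of a model category\<close>

context model_category
begin

lemma Cof_iff_lifts:
  assumes f: "f \<in> Arr M"
  shows "f \<in> Cof M \<longleftrightarrow> (\<forall>p \<in> Fib M \<inter> Weq M. lifts_against M f p)"
proof
  assume lift: "\<forall>p \<in> Fib M \<inter> Weq M. lifts_against M f p"
  obtain i p where ip: "i \<in> Cof M" "p \<in> Fib M \<inter> Weq M" "Cod M i = Dom M p" "f = p \<cdot> i"
    using factor_Cof_trivial_Fib[OF f] by blast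
  then have "retract_of M f i"
    using lift classes by (auto intro!: retract_of_first_factor)
  then show "f \<in> Cof M"
    using ip(1) by (rule retract_Cof)
qed (use lift_Cof_trivial_Fib in blast)

lemma trivial_Cof_iff_lifts:
  assumes f: "f \<in> Arr M"
  shows "f \<in> Cof M \<inter> Weq M \<longleftrightarrow> (\<forall>p \<in> Fib M. lifts_against M f p)"
proof
  assume lift: "\<forall>p \<in> Fib M. lifts_against M f p"
  obtain i p where ip: "i \<in> Cof M \<inter> Weq M" "p \<in> Fib M" "Cod M i = Dom M p" "f = p \<cdot> i"
    using factor_trivial_Cof_Fib[OF f] by blast
  then have "retract_of M f i"
    using lift classes by (auto intro!: retract_of_first_factor)
  then show "f \<in> Cof M \<inter> Weq M"
    using ip(1) retract_Cof retract_Weq by blast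
qed (use lift_trivial_Cof_Fib in blast)

lemma Fib_iff_lifts:
  assumes f: "f \<in> Arr M"
  shows "f \<in> Fib M \<longleftrightarrow> (\<forall>i \<in> Cof M \<inter> Weq M. lifts_against M i f)"
proof
  assume lift: "\<forall>i \<in> Cof M \<inter> Weq M. lifts_against M i f"
  obtain i p where ip: "i \<in> Cof M \<inter> Weq M" "p \<in> Fib M" "Cod M i = Dom M p" "f = p \<cdot> i"
    using factor_trivial_Cof_Fib[OF f] by blast
  then have "retract_of M f p"
    using lift classes by (auto intro!: retract_of_second_factor)
  then show "f \<in> Fib M"
    using ip(2) by (rule retract_Fib)
qed (use lift_trivial_Cof_Fib in blast)

lemma trivial_Fib_iff_lifts:
  assumes f: "f \<in> Arr M"
  shows "f \<in> Fib M \<inter> Weq M \<longleftrightarrow> (\<forall>i \<in> Cof M. lifts_against M i f)"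
proof
  assume lift: "\<forall>i \<in> Cof M. lifts_against M i f"
  obtain i p where ip: "i \<in> Cof M" "p \<in> Fib M \<inter> Weq M" "Cod M i = Dom M p" "f = p \<cdot> i"
    using factor_Cof_trivial_Fib[OF f] by blast
  then have "retract_of M f p"
    using lift classes by (auto intro!: retract_of_second_factor)
  then show "f \<in> Fib M \<inter> Weq M"
    using ip(2) retract_Fib retract_Weq by blast
qed (use lift_Cof_trivial_Fib in blast)

end

section \<open>Adjuncts and lifting\<close>

lemma (in cat_functor) amap_Arr:
  assumes "f \<in> Arr C"
  shows "amap F f \<in> Arr D" and "Dom D (amap F f) = omap F (Dom C f)"
    and "Cod D (amap F f) = omap F (Cod C f)"
  using amap_in_hom[OF src.in_hom[OF assms]] by (auto simp: hom_set_def)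

context adjunction
begin

text \<open>The adjunct \<open>A X \<rightarrow> Y\<close> of \<open>f : X \<rightarrow> B Y\<close>. As for \<open>adjunct\<close>, the object that
  \<open>f\<close> does not determine is an argument.\<close>

definition coadjunct :: "'p \<Rightarrow> 'm \<Rightarrow> 'n" where
  "coadjunct Y f = \<epsilon> Y \<cdot>\<^bsub>D\<^esub> amap A f"

lemma unit_in_hom: "X \<in> Obj C \<Longrightarrow> \<eta> X \<in> hom_set C X (omap B (omap A X))"
  using unit.component_in_hom by (simp add: fun_id_def fun_comp_def)

lemma counit_in_hom: "Y \<in> Obj D \<Longrightarrow> \<epsilon> Y \<in> hom_set D (omap A (omap B Y)) Y"
  using counit.component_in_hom by (simp add: fun_id_def fun_comp_def)

lemma unit_naturality:
  "f \<in> hom_set C X Y \<Longrightarrow> \<eta> Y \<cdot>\<^bsub>C\<^esub> f = amap B (amap A f) \<cdot>\<^bsub>C\<^esub> \<eta> X"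
  using unit.naturality by (simp add: fun_id_def fun_comp_def)

lemma counit_naturality:
  "g \<in> hom_set D X Y \<Longrightarrow> \<epsilon> Y \<cdot>\<^bsub>D\<^esub> amap A (amap B g) = g \<cdot>\<^bsub>D\<^esub> \<epsilon> X"
  using counit.naturality by (simp add: fun_id_def fun_comp_def)

lemma adjunct_in_hom:
  "X \<in> Obj C \<Longrightarrow> g \<in> hom_set D (omap A X) Y \<Longrightarrow> adjunct C B \<eta> X g \<in> hom_set C X (omap B Y)"
  unfolding adjunct_def
  by (rule left.src.Comp_in_hom[OF unit_in_hom right.amap_in_hom])

lemma coadjunct_in_hom:
  "Y \<in> Obj D \<Longrightarrow> f \<in> hom_set C X (omap B Y) \<Longrightarrow> coadjunct Y f \<in> hom_set D (omap A X) Y"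
  unfolding coadjunct_def
  by (rule left.tgt.Comp_in_hom[OF left.amap_in_hom counit_in_hom])

lemma coadjunct_adjunct:
  assumes X: "X \<in> Obj C" and Y: "Y \<in> Obj D" and g: "g \<in> hom_set D (omap A X) Y"
  shows "coadjunct Y (adjunct C B \<eta> X g) = g"
proof -
  note Bg = right.amap_in_hom[OF g]
  have "coadjunct Y (adjunct C B \<eta> X g)
      = \<epsilon> Y \<cdot>\<^bsub>D\<^esub> (amap A (amap B g) \<cdot>\<^bsub>D\<^esub> amap A (\<eta> X))"
    unfolding coadjunct_def adjunct_def left.amap_Comp[OF unit_in_hom[OF X] Bg] ..
  also have "\<dots> = (\<epsilon> Y \<cdot>\<^bsub>D\<^esub> amap A (amap B g)) \<cdot>\<^bsub>D\<^esub> amap A (\<eta> X)"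
    by (rule left.tgt.Comp_assoc[symmetric, OF left.amap_in_hom[OF unit_in_hom[OF X]]
          left.amap_in_hom[OF Bg] counit_in_hom[OF Y]])
  also have "\<dots> = (g \<cdot>\<^bsub>D\<^esub> \<epsilon> (omap A X)) \<cdot>\<^bsub>D\<^esub> amap A (\<eta> X)"
    by (simp add: counit_naturality[OF g])
  also have "\<dots> = g \<cdot>\<^bsub>D\<^esub> (\<epsilon> (omap A X) \<cdot>\<^bsub>D\<^esub> amap A (\<eta> X))"
    by (rule left.tgt.Comp_assoc[OF left.amap_in_hom[OF unit_in_hom[OF X]]
          counit_in_hom[OF left.omap_in_Obj[OF X]] g])
  finally show ?thesis
    by (simp add: triangle_left[OF X] left.tgt.Comp_Id[OF g])
qed

lemma adjunct_coadjunct: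
  assumes X: "X \<in> Obj C" and Y: "Y \<in> Obj D" and f: "f \<in> hom_set C X (omap B Y)"
  shows "adjunct C B \<eta> X (coadjunct Y f) = f"
proof -
  note Af = left.amap_in_hom[OF f]
  note Be = right.amap_in_hom[OF counit_in_hom[OF Y]]
  have "adjunct C B \<eta> X (coadjunct Y f)
      = (amap B (\<epsilon> Y) \<cdot>\<^bsub>C\<^esub> amap B (amap A f)) \<cdot>\<^bsub>C\<^esub> \<eta> X"
    unfolding coadjunct_def adjunct_def right.amap_Comp[OF Af counit_in_hom[OF Y]] ..
  also have "\<dots> = amap B (\<epsilon> Y) \<cdot>\<^bsub>C\<^esub> (amap B (amap A f) \<cdot>\<^bsub>C\<^esub> \<eta> X)"
    by (rule left.src.Comp_assoc[OF unit_in_hom[OF X] right.amap_in_hom[OF Af] Be])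
  also have "\<dots> = amap B (\<epsilon> Y) \<cdot>\<^bsub>C\<^esub> (\<eta> (omap B Y) \<cdot>\<^bsub>C\<^esub> f)"
    by (simp add: unit_naturality[OF f])
  also have "\<dots> = (amap B (\<epsilon> Y) \<cdot>\<^bsub>C\<^esub> \<eta> (omap B Y)) \<cdot>\<^bsub>C\<^esub> f"
    by (rule left.src.Comp_assoc[symmetric, OF f unit_in_hom[OF right.omap_in_Obj[OF Y]] Be])
  finally show ?thesis
    by (simp add: triangle_right[OF Y] left.src.Id_Comp[OF f])
qed

lemma adjunct_inject:
  assumes "X \<in> Obj C" and "Y \<in> Obj D"
    and "g \<in> hom_set D (omap A X) Y" and "h \<in> hom_set D (omap A X) Y"
    and "adjunct C B \<eta> X g = adjunct C B \<eta> X h"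
  shows "g = h"
  using coadjunct_adjunct assms by metis

lemma coadjunct_inject:
  assumes "X \<in> Obj C" and "Y \<in> Obj D"
    and "f \<in> hom_set C X (omap B Y)" and "k \<in> hom_set C X (omap B Y)"
    and "coadjunct Y f = coadjunct Y k"
  shows "f = k"
  using adjunct_coadjunct assms by metis

lemma adjunct_Comp_left_map:
  assumes X: "X \<in> Obj C" and X': "X' \<in> Obj C"
    and i: "i \<in> hom_set C X X'" and g: "g \<in> hom_set D (omap A X') Y"
  shows "adjunct C B \<eta> X (g \<cdot>\<^bsub>D\<^esub> amap A i) = adjunct C B \<eta> X' g \<cdot>\<^bsub>C\<^esub> i"
proof -
  note Ai = left.amap_in_hom[OF i]
  have "adjunct C B \<eta> X (g \<cdot>\<^bsub>D\<^esub> amap A i)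
      = amap B g \<cdot>\<^bsub>C\<^esub> amap B (amap A i) \<cdot>\<^bsub>C\<^esub> \<eta> X"
    unfolding adjunct_def right.amap_Comp[OF Ai g] ..
  also have "\<dots> = amap B g \<cdot>\<^bsub>C\<^esub> (amap B (amap A i) \<cdot>\<^bsub>C\<^esub> \<eta> X)"
    by (rule left.src.Comp_assoc[OF unit_in_hom[OF X] right.amap_in_hom[OF Ai]
          right.amap_in_hom[OF g]])
  also have "\<dots> = amap B g \<cdot>\<^bsub>C\<^esub> (\<eta> X' \<cdot>\<^bsub>C\<^esub> i)"
    by (simp add: unit_naturality[OF i])
  also have "\<dots> = adjunct C B \<eta> X' g \<cdot>\<^bsub>C\<^esub> i"
    unfolding adjunct_def
    by (rule left.src.Comp_assoc[symmetric, OF i unit_in_hom[OF X'] right.amap_in_hom[OF g]])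
  finally show ?thesis .
qed

lemma adjunct_Comp:
  assumes X: "X \<in> Obj C"
    and g: "g \<in> hom_set D (omap A X) Y" and p: "p \<in> hom_set D Y Z"
  shows "adjunct C B \<eta> X (p \<cdot>\<^bsub>D\<^esub> g) = amap B p \<cdot>\<^bsub>C\<^esub> adjunct C B \<eta> X g"
  unfolding adjunct_def right.amap_Comp[OF g p]
  by (rule left.src.Comp_assoc[OF unit_in_hom[OF X] right.amap_in_hom[OF g]
        right.amap_in_hom[OF p]])

text \<open>Taking adjuncts is natural in both variables, so it is a bijection between the commutative
  squares from \<open>A i\<close> to \<open>p\<close> and those from \<open>i\<close> to \<open>B p\<close>, and between their fillers.\<close>

lemma lifts_against_iff:
  assumes i: "i \<in> Arr C" and p: "p \<in> Arr D"
  shows "lifts_against D (amap A i) p \<longleftrightarrow> lifts_against C i (amap B p)"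
proof -
  let ?X = "Dom C i" and ?X' = "Cod C i" and ?E = "Dom D p" and ?Z = "Cod D p"
  let ?adj = "adjunct C B \<eta>"
  have obj: "?X \<in> Obj C" "?X' \<in> Obj C" "?E \<in> Obj D" "?Z \<in> Obj D"
    using i p left.src.Dom_in_Obj left.src.Cod_in_Obj left.tgt.Dom_in_Obj left.tgt.Cod_in_Obj
    by auto
  note ih = left.src.in_hom[OF i] and ph = left.tgt.in_hom[OF p]
  note Ai = left.amap_in_hom[OF ih]
  note map_simps = left.amap_Arr(2,3)[OF i] right.amap_Arr(2,3)[OF p]
  have square_iff: "p \<cdot>\<^bsub>D\<^esub> f = g \<cdot>\<^bsub>D\<^esub> amap A i \<longleftrightarrow>
      amap B p \<cdot>\<^bsub>C\<^esub> ?adj ?X f = ?adj ?X' g \<cdot>\<^bsub>C\<^esub> i"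
    if f: "f \<in> hom_set D (omap A ?X) ?E" and g: "g \<in> hom_set D (omap A ?X') ?Z" for f g
    using adjunct_Comp[OF obj(1) f ph] adjunct_Comp_left_map[OF obj(1,2) ih g]
      adjunct_inject[OF obj(1,4) left.tgt.Comp_in_hom[OF f ph] left.tgt.Comp_in_hom[OF Ai g]]
    by auto
  have filler_iff: "h \<cdot>\<^bsub>D\<^esub> amap A i = f \<and> p \<cdot>\<^bsub>D\<^esub> h = g \<longleftrightarrow>
      ?adj ?X' h \<cdot>\<^bsub>C\<^esub> i = ?adj ?X f \<and> amap B p \<cdot>\<^bsub>C\<^esub> ?adj ?X' h = ?adj ?X' g"
    if f: "f \<in> hom_set D (omap A ?X) ?E" and g: "g \<in> hom_set D (omap A ?X') ?Z"
      and h: "h \<in> hom_set D (omap A ?X') ?E" for f g h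
    using adjunct_Comp[OF obj(2) h ph] adjunct_Comp_left_map[OF obj(1,2) ih h]
      adjunct_inject[OF obj(1,3) left.tgt.Comp_in_hom[OF Ai h] f]
      adjunct_inject[OF obj(2,4) left.tgt.Comp_in_hom[OF h ph] g]
    by auto
  show ?thesis
  proof
    assume lift: "lifts_against D (amap A i) p"
    show "lifts_against C i (amap B p)"
      unfolding lifts_against_def map_simps
    proof (intro ballI impI)
      fix f g
      assume f: "f \<in> hom_set C ?X (omap B ?E)" and g: "g \<in> hom_set C ?X' (omap B ?Z)"
        and sq: "amap B p \<cdot>\<^bsub>C\<^esub> f = g \<cdot>\<^bsub>C\<^esub> i"
      let ?f = "coadjunct ?E f" and ?g = "coadjunct ?Z g"
      have f': "?f \<in> hom_set D (omap A ?X) ?E" "?adj ?X ?f = f"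
        and g': "?g \<in> hom_set D (omap A ?X') ?Z" "?adj ?X' ?g = g"
        using coadjunct_in_hom adjunct_coadjunct obj f g by auto
      have "p \<cdot>\<^bsub>D\<^esub> ?f = ?g \<cdot>\<^bsub>D\<^esub> amap A i"
        using square_iff[OF f'(1) g'(1)] f'(2) g'(2) sq by simp
      then obtain h where h: "h \<in> hom_set D (omap A ?X') ?E"
        and "h \<cdot>\<^bsub>D\<^esub> amap A i = ?f \<and> p \<cdot>\<^bsub>D\<^esub> h = ?g"
        using lift f'(1) g'(1) unfolding lifts_against_def map_simps by blast
      then have "?adj ?X' h \<cdot>\<^bsub>C\<^esub> i = f \<and> amap B p \<cdot>\<^bsub>C\<^esub> ?adj ?X' h = g"
        using filler_iff[OF f'(1) g'(1) h] f'(2) g'(2) by simp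
      then show "\<exists>k \<in> hom_set C ?X' (omap B ?E). k \<cdot>\<^bsub>C\<^esub> i = f \<and> amap B p \<cdot>\<^bsub>C\<^esub> k = g"
        using adjunct_in_hom[OF obj(2) h] by blast
    qed
  next
    assume lift: "lifts_against C i (amap B p)"
    show "lifts_against D (amap A i) p"
      unfolding lifts_against_def map_simps
    proof (intro ballI impI)
      fix f g
      assume f: "f \<in> hom_set D (omap A ?X) ?E" and g: "g \<in> hom_set D (omap A ?X') ?Z"
        and sq: "p \<cdot>\<^bsub>D\<^esub> f = g \<cdot>\<^bsub>D\<^esub> amap A i"
      obtain k where k: "k \<in> hom_set C ?X' (omap B ?E)"
        and fill: "k \<cdot>\<^bsub>C\<^esub> i = ?adj ?X f \<and> amap B p \<cdot>\<^bsub>C\<^esub> k = ?adj ?X' g"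
        using lift square_iff[OF f g] sq adjunct_in_hom[OF obj(1) f] adjunct_in_hom[OF obj(2) g]
        unfolding lifts_against_def map_simps by blast
      have h: "coadjunct ?E k \<in> hom_set D (omap A ?X') ?E"
        by (rule coadjunct_in_hom[OF obj(3) k])
      have "coadjunct ?E k \<cdot>\<^bsub>D\<^esub> amap A i = f \<and> p \<cdot>\<^bsub>D\<^esub> coadjunct ?E k = g"
        using filler_iff[OF f g h] adjunct_coadjunct[OF obj(2,3) k] fill by simp
      then show "\<exists>h \<in> hom_set D (omap A ?X') ?E. h \<cdot>\<^bsub>D\<^esub> amap A i = f \<and> p \<cdot>\<^bsub>D\<^esub> h = g"
        using h by blast
    qed
  qed
qed

end

section \<open>Quillen adjunctions in terms of the right adjoint\<close>

text \<open>Both sides say that \<open>A i\<close> lifts against \<open>p\<close>, equivalently \<open>i\<close> against \<open>B p\<close>, whenever \<open>i\<close> is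
  a cofibration and \<open>p\<close> a fibration one of which is trivial.\<close>

lemma quillen_adjunction_iff_right:
  assumes M: "model_category TYPE('s) M" and M': "model_category TYPE('t) M'"
    and adj: "adjunction M M' A B \<eta> \<epsilon>"
  shows "quillen_adjunction M M' A B \<eta> \<epsilon> \<longleftrightarrow>
    (\<forall>p \<in> Fib M'. amap B p \<in> Fib M) \<and>
    (\<forall>p \<in> Fib M' \<inter> Weq M'. amap B p \<in> Fib M \<inter> Weq M)"
proof -
  interpret M: model_category "TYPE('s)" M by (rule M)
  interpret M': model_category "TYPE('t)" M' by (rule M')
  interpret adjunction M M' A B \<eta> \<epsilon> by (rule adj)
  have Arr: "i \<in> Cof M \<Longrightarrow> i \<in> Arr M" "p \<in> Fib M' \<Longrightarrow> p \<in> Arr M'" for i p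
    using M.classes M'.classes by auto
  have "(\<forall>i \<in> Cof M. amap A i \<in> Cof M')
      \<longleftrightarrow> (\<forall>i \<in> Cof M. \<forall>p \<in> Fib M' \<inter> Weq M'. lifts_against M' (amap A i) p)"
    using M'.Cof_iff_lifts left.amap_Arr(1) Arr by blast
  also have "\<dots> \<longleftrightarrow> (\<forall>p \<in> Fib M' \<inter> Weq M'. \<forall>i \<in> Cof M. lifts_against M i (amap B p))"
    using lifts_against_iff Arr by blast
  also have "\<dots> \<longleftrightarrow> (\<forall>p \<in> Fib M' \<inter> Weq M'. amap B p \<in> Fib M \<inter> Weq M)"
    using M.trivial_Fib_iff_lifts right.amap_Arr(1) Arr by blast
  finally have cof: "(\<forall>i \<in> Cof M. amap A i \<in> Cof M')
      \<longleftrightarrow> (\<forall>p \<in> Fib M' \<inter> Weq M'. amap B p \<in> Fib M \<inter> Weq M)" .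
  have "(\<forall>i \<in> Cof M \<inter> Weq M. amap A i \<in> Cof M' \<inter> Weq M')
      \<longleftrightarrow> (\<forall>i \<in> Cof M \<inter> Weq M. \<forall>p \<in> Fib M'. lifts_against M' (amap A i) p)"
    using M'.trivial_Cof_iff_lifts left.amap_Arr(1) Arr by blast
  also have "\<dots> \<longleftrightarrow> (\<forall>p \<in> Fib M'. \<forall>i \<in> Cof M \<inter> Weq M. lifts_against M i (amap B p))"
    using lifts_against_iff Arr by blast
  also have "\<dots> \<longleftrightarrow> (\<forall>p \<in> Fib M'. amap B p \<in> Fib M)"
    using M.Fib_iff_lifts right.amap_Arr(1) Arr by blast
  finally show ?thesis
    unfolding quillen_adjunction_def using adj cof by blast
qed

section \<open>Maps of adjunctions preserve adjuncts\<close>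

text \<open>The coadjuncts of both sides are the identity of \<open>A (F X)\<close>, by the left triangle
  identities of the two adjunctions; the one for \<open>F (\<eta>1 X)\<close> is the image under \<open>F'\<close> of the
  triangle identity in \<open>N'\<close>.\<close>

lemma map_of_adjunctions_unit:
  assumes map: "map_of_adjunctions N N' A1 B1 \<eta>1 \<epsilon>1 M M' A B \<eta> \<epsilon> F F'"
    and X: "X \<in> Obj N"
  shows "amap F (\<eta>1 X) = \<eta> (omap F X)"
proof -
  interpret N: adjunction N N' A1 B1 \<eta>1 \<epsilon>1
    using map by (simp add: map_of_adjunctions_def)
  interpret M: adjunction M M' A B \<eta> \<epsilon>
    using map by (simp add: map_of_adjunctions_def)
  interpret F: cat_functor N M F
    using map by (simp add: map_of_adjunctions_def)
  interpret F': cat_functor N' M' F'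
    using map by (simp add: map_of_adjunctions_def)
  let ?Y = "omap A1 X"
  have Y: "?Y \<in> Obj N'" and FX: "omap F X \<in> Obj M"
    using X N.left.omap_in_Obj F.omap_in_Obj by auto
  note unit1 = N.unit_in_hom[OF X]
  have AF_obj: "omap A (omap F X) = omap F' ?Y"
    and FB_obj: "omap F (omap B1 ?Y) = omap B (omap F' ?Y)"
    and AF_unit: "amap A (amap F (\<eta>1 X)) = amap F' (amap A1 (\<eta>1 X))"
    and counit: "\<epsilon> (omap F' ?Y) = amap F' (\<epsilon>1 ?Y)"
    using map X Y unit1
    by (auto simp: map_of_adjunctions_def fun_eq_def fun_comp_def hom_set_def)
  have Funit: "amap F (\<eta>1 X) \<in> hom_set M (omap F X) (omap B (omap F' ?Y))"
    using F.amap_in_hom[OF unit1] by (simp add: FB_obj)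
  have unitF: "\<eta> (omap F X) \<in> hom_set M (omap F X) (omap B (omap F' ?Y))"
    using M.unit_in_hom[OF FX] by (simp add: AF_obj)
  have "M.coadjunct (omap F' ?Y) (amap F (\<eta>1 X))
      = amap F' (\<epsilon>1 ?Y) \<cdot>\<^bsub>M'\<^esub> amap F' (amap A1 (\<eta>1 X))"
    unfolding M.coadjunct_def AF_unit counit ..
  also have "\<dots> = amap F' (\<epsilon>1 ?Y \<cdot>\<^bsub>N'\<^esub> amap A1 (\<eta>1 X))"
    using F'.amap_Comp[OF N.left.amap_in_hom[OF unit1] N.counit_in_hom[OF Y]] by simp
  also have "\<dots> = Id M' (omap F' ?Y)"
    by (simp add: N.triangle_left[OF X] F'.amap_Id[OF Y])
  also have "\<dots> = M.coadjunct (omap F' ?Y) (\<eta> (omap F X))"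
    using M.triangle_left[OF FX] by (simp add: M.coadjunct_def AF_obj)
  finally show ?thesis
    by (rule M.coadjunct_inject[OF FX F'.omap_in_Obj[OF Y] Funit unitF])
qed

lemma map_of_adjunctions_adjunct:
  assumes map: "map_of_adjunctions N N' A1 B1 \<eta>1 \<epsilon>1 M M' A B \<eta> \<epsilon> F F'"
    and X: "X \<in> Obj N" and g: "g \<in> hom_set N' (omap A1 X) Y"
  shows "amap F (adjunct N B1 \<eta>1 X g) = adjunct M B \<eta> (omap F X) (amap F' g)"
proof -
  interpret N: adjunction N N' A1 B1 \<eta>1 \<epsilon>1
    using map by (simp add: map_of_adjunctions_def)
  interpret F: cat_functor N M F
    using map by (simp add: map_of_adjunctions_def)
  have "amap F (amap B1 g) = amap B (amap F' g)"
    using map g by (auto simp: map_of_adjunctions_def fun_eq_def fun_comp_def hom_set_def)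
  then show ?thesis
    using F.amap_Comp[OF N.unit_in_hom[OF X] N.right.amap_in_hom[OF g]]
      map_of_adjunctions_unit[OF map X]
    by (simp add: adjunct_def)
qed

section \<open>Transport of Quillen equivalences\<close>

theorem theorem5p6:
  fixes N :: "('o1, 'm1) model_cat" and N' :: "('o2, 'm2) model_cat"
    and M :: "('o3, 'm3) model_cat" and M' :: "('o4, 'm4) model_cat"
    and F :: "('o1, 'm1, 'o3, 'm3) fun_data" and F' :: "('o2, 'm2, 'o4, 'm4) fun_data"
    and At :: "('o1, 'm1, 'o2, 'm2) fun_data" and Bt :: "('o2, 'm2, 'o1, 'm1) fun_data"
    and A :: "('o3, 'm3, 'o4, 'm4) fun_data" and B :: "('o4, 'm4, 'o3, 'm3) fun_data"
    and \<eta>t :: "'o1 \<Rightarrow> 'm1" and \<epsilon>t :: "'o2 \<Rightarrow> 'm2"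
    and \<eta> :: "'o3 \<Rightarrow> 'm3" and \<epsilon> :: "'o4 \<Rightarrow> 'm4"
  assumes "model_category TYPE('s) N" and "model_category TYPE('s) N'"
    and "model_category TYPE('s) M" and "model_category TYPE('s) M'"
    and "cat_functor N M F" and "cat_functor N' M' F'"
    and "adjunction N N' At Bt \<eta>t \<epsilon>t" and "adjunction M M' A B \<eta> \<epsilon>"
    and "map_of_adjunctions N N' At Bt \<eta>t \<epsilon>t M M' A B \<eta> \<epsilon> F F'"
    and "quillen_equivalence M M' A B \<eta> \<epsilon>"
    and "creates_weak_equivalences N M F" and "creates_weak_equivalences N' M' F'"
    and "reflects_fibrations N M F" and "preserves_cofibrant_objects N M F"
    and "preserves_fibrations N' M' F'" and "preserves_fibrant_objects N' M' F'"
  shows "quillen_equivalence N N' At Bt \<eta>t \<epsilon>t"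
proof -
  interpret N': model_category "TYPE('s)" N' by fact
  interpret Adj: adjunction N N' At Bt \<eta>t \<epsilon>t by fact
  interpret F': cat_functor N' M' F' by fact
  note map = \<open>map_of_adjunctions N N' At Bt \<eta>t \<epsilon>t M M' A B \<eta> \<epsilon> F F'\<close>
  note QE = \<open>quillen_equivalence M M' A B \<eta> \<epsilon>\<close>
  have F_Weq: "amap F f \<in> Weq M \<longleftrightarrow> f \<in> Weq N" if "f \<in> Arr N" for f
    using \<open>creates_weak_equivalences N M F\<close> that by (simp add: creates_weak_equivalences_def)
  have F'_Weq: "amap F' f \<in> Weq M' \<longleftrightarrow> f \<in> Weq N'" if "f \<in> Arr N'" for f
    using \<open>creates_weak_equivalences N' M' F'\<close> that by (simp add: creates_weak_equivalences_def)
  have F_Fib: "f \<in> Fib N" if "f \<in> Arr N" "amap F f \<in> Fib M" for f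
    using \<open>reflects_fibrations N M F\<close> that by (simp add: reflects_fibrations_def)
  have F'_Fib: "amap F' f \<in> Fib M'" if "f \<in> Arr N'" "f \<in> Fib N'" for f
    using \<open>preserves_fibrations N' M' F'\<close> that by (simp add: preserves_fibrations_def)
  have B: "amap B p \<in> Fib M" "p \<in> Weq M' \<Longrightarrow> amap B p \<in> Weq M" if "p \<in> Fib M'" for p
    using QE that quillen_adjunction_iff_right[OF \<open>model_category TYPE('s) M\<close>
        \<open>model_category TYPE('s) M'\<close> \<open>adjunction M M' A B \<eta> \<epsilon>\<close>]
    by (auto simp: quillen_equivalence_def)
  have FB: "amap F (amap Bt p) = amap B (amap F' p)" if "p \<in> Arr N'" for p
    using map that by (simp add: map_of_adjunctions_def fun_eq_def fun_comp_def)
  have Bt: "amap Bt p \<in> Fib N \<and> (p \<in> Weq N' \<longrightarrow> amap Bt p \<in> Weq N)" if p: "p \<in> Fib N'" for p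
  proof -
    have pA: "p \<in> Arr N'"
      using p N'.classes by blast
    note BtA = Adj.right.amap_Arr(1)[OF pA]
    show ?thesis
      using B[OF F'_Fib[OF pA p]] F_Fib[OF BtA] F_Weq[OF BtA] F'_Weq[OF pA] FB[OF pA] by auto
  qed
  have QA: "quillen_adjunction N N' At Bt \<eta>t \<epsilon>t"
    using Bt quillen_adjunction_iff_right[OF \<open>model_category TYPE('s) N\<close>
        \<open>model_category TYPE('s) N'\<close> \<open>adjunction N N' At Bt \<eta>t \<epsilon>t\<close>] by blast
  have "g \<in> Weq N' \<longleftrightarrow> adjunct N Bt \<eta>t X g \<in> Weq N"
    if cofX: "cofibrant N X" and fibY: "fibrant N' Y" and g: "g \<in> hom_set N' (omap At X) Y"
    for X Y g
  proof -
    have X: "X \<in> Obj N"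
      using cofX by (simp add: cofibrant_def)
    have gA: "g \<in> Arr N'"
      using g by (simp add: hom_set_def)
    have adjA: "adjunct N Bt \<eta>t X g \<in> Arr N"
      using Adj.adjunct_in_hom[OF X g] by (simp add: hom_set_def)
    have "omap A (omap F X) = omap F' (omap At X)"
      using map X by (simp add: map_of_adjunctions_def fun_eq_def fun_comp_def)
    then have F'g: "amap F' g \<in> hom_set M' (omap A (omap F X)) (omap F' Y)"
      using F'.amap_in_hom[OF g] by simp
    have "cofibrant M (omap F X)" and "fibrant M' (omap F' Y)"
      using cofX fibY \<open>preserves_cofibrant_objects N M F\<close> \<open>preserves_fibrant_objects N' M' F'\<close>
      by (auto simp: preserves_cofibrant_objects_def preserves_fibrant_objects_def)
    then have "amap F' g \<in> Weq M' \<longleftrightarrow> adjunct M B \<eta> (omap F X) (amap F' g) \<in> Weq M"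
      using QE F'g by (auto simp: quillen_equivalence_def)
    then show ?thesis
      using F'_Weq[OF gA] F_Weq[OF adjA] map_of_adjunctions_adjunct[OF map X g] by simp
  qed
  then show ?thesis
    using QA by (auto simp: quillen_equivalence_def)
qed

end
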